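(* Let $\mathcal{M}_1$ be a general rotational surface of elliptic type in $\mathbb{E}^4_2$ with plane meridian curve $m$, i.e. the Lorentz surface $$z(u,v)=\left(f(u)\cos\alpha v,\ f(u)\sin\alpha v,\ g(u)\cos\beta v,\ g(u)\sin\beta v\right),\quad u\in J,\ v\in[0,2\pi),$$ where $\alpha,\beta$ are positive constants and $f,g$ are smooth functions on $J$ with $\alpha^2f^2-\beta^2g^2<0$ and $f'^2-g'^2>0$. Then $\mathcal{M}_1$ is flat if and only if the meridian curve $m$ is determined by one of the following: (i) $\beta^2g^2-\alpha^2f^2=a^2(u+c)^2$, where $a=const\neq0$, $c=const$; (ii) $\alpha^2f^2-\beta^2g^2=C$, where $C=const$, $C<0$.
   Context: $\mathbb{E}^4_2$ is $\mathbb{R}^4$ with the metric $dx_1^2+dx_2^2-dx_3^2-dx_4^2$, and $J\subset\mathbb{R}$ is the domain of the parameter $u$. The meridian curve $m$ is the plane curve $u\mapsto(f(u),0,g(u),0)$. A surface in $\mathbb{E}^4_2$ is Lorentz if its induced metric has signature $(1,1)$; here the first fundamental form is $E=f'^2-g'^2>0$, $F=0$, $G=\alpha^2f^2-\beta^2g^2<0$. The surface is flat if its Gauss curvature $K=\dfrac{\langle\sigma(x,x),\sigma(y,y)\rangle-\langle\sigma(x,y),\sigma(x,y)\rangle}{\langle x,x\rangle\langle y,y\rangle-\langle x,y\rangle^2}$ (with $\sigma$ the second fundamental form and $x,y$ a tangent frame) vanishes identically.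
   Formalization: In (i), u is replaced by an arc-length parameter s of m (u itself if f'^2-g'^2=1), since (i) fails for general u: α=β=1, f=u sinh(u^2), g=u cosh(u^2) on (1,2) satisfies (i) but is not flat. J is taken to be an open interval. *)

theory Defs
  imports "HOL-Analysis.Analysis"
begin

(* C-infinity functions; meant for an open set J, on which every iterated derivative is
   then the usual two-sided one. *)
definition smooth_on :: "real set \<Rightarrow> (real \<Rightarrow> real) \<Rightarrow> bool" where
  "smooth_on J f \<longleftrightarrow> (\<forall>n. \<forall>u\<in>J. (deriv ^^ n) f differentiable (at u))"

(* The metric of E^4_2. *)
definition neutral :: "real^4 \<Rightarrow> real^4 \<Rightarrow> real" where
  "neutral x y = x$1 * y$1 + x$2 * y$2 - x$3 * y$3 - x$4 * y$4"

(* A parametrized surface is a map z of the two parameters u and v. *)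
definition d_u :: "(real \<Rightarrow> real \<Rightarrow> real^4) \<Rightarrow> real \<Rightarrow> real \<Rightarrow> real^4" where
  "d_u z u v = vector_derivative (\<lambda>t. z t v) (at u)"

definition d_v :: "(real \<Rightarrow> real \<Rightarrow> real^4) \<Rightarrow> real \<Rightarrow> real \<Rightarrow> real^4" where
  "d_v z u v = vector_derivative (\<lambda>t. z u t) (at v)"

(* The component of w normal to the plane spanned by x and y. It is well defined when the
   metric is nondegenerate on that plane, in particular for tangent planes of Lorentz
   surfaces. *)
definition normal_component :: "real^4 \<Rightarrow> real^4 \<Rightarrow> real^4 \<Rightarrow> real^4" where
  "normal_component x y w =
     (THE n. neutral n x = 0 \<and> neutral n y = 0 \<and> w - n \<in> span {x, y})"

(* The second fundamental form sigma evaluated on the coordinate frame (z_u, z_v). By the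
   Gauss formula it is the normal component of the second partial derivatives, since the
   ambient Levi-Civita connection is the flat one. *)
definition sigma_uu :: "(real \<Rightarrow> real \<Rightarrow> real^4) \<Rightarrow> real \<Rightarrow> real \<Rightarrow> real^4" where
  "sigma_uu z u v = normal_component (d_u z u v) (d_v z u v) (d_u (d_u z) u v)"

definition sigma_uv :: "(real \<Rightarrow> real \<Rightarrow> real^4) \<Rightarrow> real \<Rightarrow> real \<Rightarrow> real^4" where
  "sigma_uv z u v = normal_component (d_u z u v) (d_v z u v) (d_u (d_v z) u v)"

definition sigma_vv :: "(real \<Rightarrow> real \<Rightarrow> real^4) \<Rightarrow> real \<Rightarrow> real \<Rightarrow> real^4" where
  "sigma_vv z u v = normal_component (d_u z u v) (d_v z u v) (d_v (d_v z) u v)"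

(* Written in the tangent frame x = z_u, y = z_v; the value is the same for every frame. *)
definition gauss_curvature :: "(real \<Rightarrow> real \<Rightarrow> real^4) \<Rightarrow> real \<Rightarrow> real \<Rightarrow> real" where
  "gauss_curvature z u v =
     (neutral (sigma_uu z u v) (sigma_vv z u v) - neutral (sigma_uv z u v) (sigma_uv z u v)) /
     (neutral (d_u z u v) (d_u z u v) * neutral (d_v z u v) (d_v z u v)
        - (neutral (d_u z u v) (d_v z u v))\<^sup>2)"

definition flat_surface :: "real set \<Rightarrow> real set \<Rightarrow> (real \<Rightarrow> real \<Rightarrow> real^4) \<Rightarrow> bool" where
  "flat_surface J V z \<longleftrightarrow> (\<forall>u\<in>J. \<forall>v\<in>V. gauss_curvature z u v = 0)"

definition meridian_curve :: "(real \<Rightarrow> real) \<Rightarrow> (real \<Rightarrow> real) \<Rightarrow> real \<Rightarrow> real^4" where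
  "meridian_curve f g u = vector [f u, 0, g u, 0]"

(* The formula makes sense for every real v, so that the derivatives in v are two-sided at
   v = 0 as well; the surface itself is its restriction to v in [0, 2 pi). *)
definition rotational_surface ::
  "real \<Rightarrow> real \<Rightarrow> (real \<Rightarrow> real) \<Rightarrow> (real \<Rightarrow> real) \<Rightarrow> real \<Rightarrow> real \<Rightarrow> real^4" where
  "rotational_surface \<alpha> \<beta> f g u v =
     vector [f u * cos (\<alpha> * v), f u * sin (\<alpha> * v), g u * cos (\<beta> * v), g u * sin (\<beta> * v)]"

(* s is an arc-length (natural) parameter of the spacelike curve m on J. It is determined
   by m up to an additive constant when J is an interval. *)
definition arc_length_parameter :: "real set \<Rightarrow> (real \<Rightarrow> real^4) \<Rightarrow> (real \<Rightarrow> real) \<Rightarrow> bool" where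
  "arc_length_parameter J m s \<longleftrightarrow>
     (\<forall>u\<in>J. (s has_real_derivative
        sqrt (neutral (vector_derivative m (at u)) (vector_derivative m (at u)))) (at u))"

end

theory Submission
  imports Defs
begin

text \<open>
  Only the intrinsic geometry of the surface matters. With \<open>E = f'\<^sup>2 - g'\<^sup>2 > 0\<close> and
  \<open>P = \<beta>\<^sup>2 g\<^sup>2 - \<alpha>\<^sup>2 f\<^sup>2 > 0\<close> the induced metric is \<open>E du\<^sup>2 - P dv\<^sup>2\<close> and depends on \<open>u\<close> alone.
  In an arc-length parameter \<open>s\<close> of the meridian it reads \<open>ds\<^sup>2 - P dv\<^sup>2\<close>, so its curvature is,
  up to sign, the second \<open>s\<close>-derivative of \<open>\<surd>P\<close> divided by \<open>\<surd>P\<close>. The surface is therefore flat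
  exactly when \<open>\<surd>P\<close> is an affine function of \<open>s\<close>: a nonconstant one gives \<open>P = a\<^sup>2 (s + c)\<^sup>2\<close>,
  a constant one makes \<open>P\<close> constant.

  Curvature is defined here through the second fundamental form, so the Gauss equation has to be
  verified for this metric. That is a computation in the moving frame obtained by rotating the
  two coordinate planes by \<open>\<alpha>v\<close> and \<open>\<beta>v\<close>: the coordinates of every partial derivative in this
  frame are free of \<open>v\<close> (\<open>gauss_curvature_rotational\<close>).

  The differential equation is solved without integrating \<open>\<surd>E\<close>. Flatness says that the
  \<open>s\<close>-derivative of \<open>\<surd>P\<close>, namely \<open>P' / (2 \<surd>P \<surd>E)\<close>, is a constant \<open>a\<close> on the interval. If
  \<open>a \<noteq> 0\<close>, then \<open>\<surd>P / a\<close> itself is an arc-length parameter (\<open>curvature_ode_solution\<close>).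
\<close>

section \<open>Normal components in the neutral metric\<close>

lemma neutral_commute: "neutral x y = neutral y x"
  by (simp add: neutral_def mult.commute)

lemma neutral_diff_left: "neutral (x - y) w = neutral x w - neutral y w"
  by (simp add: neutral_def algebra_simps)

lemma neutral_diff_right: "neutral w (x - y) = neutral w x - neutral w y"
  by (simp add: neutral_def algebra_simps)

lemma neutral_add_left: "neutral (x + y) w = neutral x w + neutral y w"
  by (simp add: neutral_def algebra_simps)

lemma neutral_add_right: "neutral w (x + y) = neutral w x + neutral w y"
  by (simp add: neutral_def algebra_simps)

lemma neutral_scaleR_left: "neutral (c *\<^sub>R x) w = c * neutral x w"
  by (simp add: neutral_def algebra_simps)

lemma neutral_scaleR_right: "neutral w (c *\<^sub>R x) = c * neutral w x"
  by (simp add: neutral_def algebra_simps)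

lemmas neutral_bilinear = neutral_diff_left neutral_diff_right neutral_add_left neutral_add_right
  neutral_scaleR_left neutral_scaleR_right

text \<open>For an orthogonal pair of non-null vectors the Gram-Schmidt formula gives a normal
  component. It is the only one: the difference of two candidates lies in the span of the pair
  and is orthogonal to it, and the metric is nondegenerate there.\<close>

lemma normal_component_orthogonal:
  assumes xx: "neutral x x \<noteq> 0" and yy: "neutral y y \<noteq> 0" and xy: "neutral x y = 0"
  shows "normal_component x y w =
    w - (neutral w x / neutral x x) *\<^sub>R x - (neutral w y / neutral y y) *\<^sub>R y"
    (is "_ = ?n")
  unfolding normal_component_def
proof (rule the_equality)
  have yx: "neutral y x = 0"
    using xy by (simp add: neutral_commute)
  have "w - ?n = (neutral w x / neutral x x) *\<^sub>R x + (neutral w y / neutral y y) *\<^sub>R y"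
    by simp
  then have "w - ?n \<in> span {x, y}"
    by (simp only:) (intro span_add span_mul span_base; simp)
  then show "neutral ?n x = 0 \<and> neutral ?n y = 0 \<and> w - ?n \<in> span {x, y}"
    using xx yy xy yx by (simp add: neutral_bilinear)
next
  fix n assume n: "neutral n x = 0 \<and> neutral n y = 0 \<and> w - n \<in> span {x, y}"
  have yx: "neutral y x = 0"
    using xy by (simp add: neutral_commute)
  obtain p q where pq: "w - n = p *\<^sub>R x + q *\<^sub>R y"
  proof -
    obtain p where "w - n - p *\<^sub>R x \<in> span {y}"
      using n span_breakdown_eq[of "w - n" x "{y}"] by auto
    then obtain q where "w - n - p *\<^sub>R x = q *\<^sub>R y"
      by (auto simp: span_singleton)
    then show thesis
      using that[of p q] by (simp add: algebra_simps)
  qed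
  have "neutral w x = p * neutral x x" "neutral w y = q * neutral y y"
    using arg_cong[OF pq, of "\<lambda>t. neutral t x"] arg_cong[OF pq, of "\<lambda>t. neutral t y"] n xy yx
    by (simp_all add: neutral_bilinear)
  then show "n = ?n"
    using pq xx yy by (simp add: algebra_simps)
qed

lemma neutral_normal_components:
  assumes "neutral x x \<noteq> 0" and "neutral y y \<noteq> 0" and "neutral x y = 0"
  shows "neutral (normal_component x y w) (normal_component x y w') =
    neutral w w' - neutral w x * neutral w' x / neutral x x
      - neutral w y * neutral w' y / neutral y y"
proof -
  have yx: "neutral y x = 0"
    using assms by (simp add: neutral_commute)
  have "neutral x w' = neutral w' x" "neutral y w' = neutral w' y"
    by (rule neutral_commute)+
  then show ?thesis
    using assms yx by (simp add: normal_component_orthogonal neutral_bilinear field_simps)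
qed

section \<open>The moving frame of a rotational surface\<close>

text \<open>The vector with coordinates \<open>(p, q, r, s)\<close> in the orthonormal frame obtained from the
  standard basis by rotating the first two axes by \<open>\<alpha>v\<close> and the last two by \<open>\<beta>v\<close>.\<close>

definition rotated_frame ::
  "real \<Rightarrow> real \<Rightarrow> real \<Rightarrow> real \<Rightarrow> real \<Rightarrow> real \<Rightarrow> real \<Rightarrow> real^4" where
  "rotated_frame \<alpha> \<beta> v p q r s =
     vector [p * cos (\<alpha> * v) - q * sin (\<alpha> * v), p * sin (\<alpha> * v) + q * cos (\<alpha> * v),
             r * cos (\<beta> * v) - s * sin (\<beta> * v), r * sin (\<beta> * v) + s * cos (\<beta> * v)]"

lemma vector_4 [simp]:
  "(vector [a, b, c, d] :: real^4) $ 1 = a"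
  "(vector [a, b, c, d] :: real^4) $ 2 = b"
  "(vector [a, b, c, d] :: real^4) $ 3 = c"
  "(vector [a, b, c, d] :: real^4) $ 4 = d"
  by (simp_all add: vector_def)

lemma rotational_surface_frame:
  "rotational_surface \<alpha> \<beta> f g = (\<lambda>u v. rotated_frame \<alpha> \<beta> v (f u) 0 (g u) 0)"
  by (intro ext) (simp add: rotational_surface_def rotated_frame_def)

lemma neutral_rotated_frame:
  "neutral (rotated_frame \<alpha> \<beta> v p q r s) (rotated_frame \<alpha> \<beta> v p' q' r' s') =
     p * p' + q * q' - r * r' - s * s'"
proof -
  have rot: "(a * c - b * t) * (a' * c - b' * t) + (a * t + b * c) * (a' * t + b' * c)
      = (a * a' + b * b') * (t\<^sup>2 + c\<^sup>2)" for a b a' b' c t :: real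
    by algebra
  show ?thesis
    using rot[of p "cos (\<alpha> * v)" q "sin (\<alpha> * v)" p' q']
      rot[of r "cos (\<beta> * v)" s "sin (\<beta> * v)" r' s']
    by (simp add: neutral_def rotated_frame_def)
qed

lemma has_vector_derivative_vector_4:
  assumes "(a has_real_derivative a') (at x)" "(b has_real_derivative b') (at x)"
    "(c has_real_derivative c') (at x)" "(d has_real_derivative d') (at x)"
  shows "((\<lambda>t. vector [a t, b t, c t, d t] :: real^4)
    has_vector_derivative vector [a', b', c', d']) (at x)"
proof -
  have basis: "(vector [p, q, r, s] :: real^4) =
      p *\<^sub>R axis 1 1 + q *\<^sub>R axis 2 1 + r *\<^sub>R axis 3 1 + s *\<^sub>R axis 4 1" for p q r s :: real
    by (simp add: vec_eq_iff forall_4 axis_def)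
  show ?thesis
    unfolding basis
    using assms by (auto intro!: derivative_eq_intros)
qed

lemma vector_derivative_rotated_frame_u:
  assumes "(p has_real_derivative p') (at u)" "(q has_real_derivative q') (at u)"
    "(r has_real_derivative r') (at u)" "(s has_real_derivative s') (at u)"
  shows "((\<lambda>t. rotated_frame \<alpha> \<beta> v (p t) (q t) (r t) (s t))
    has_vector_derivative rotated_frame \<alpha> \<beta> v p' q' r' s') (at u)"
  unfolding rotated_frame_def
  using assms by (intro has_vector_derivative_vector_4) (auto intro!: derivative_eq_intros)

text \<open>Differentiation in \<open>v\<close> acts on the frame coordinates as the infinitesimal rotation.\<close>

lemma vector_derivative_rotated_frame_v:
  "((\<lambda>t. rotated_frame \<alpha> \<beta> t p q r s)
    has_vector_derivative rotated_frame \<alpha> \<beta> v (- \<alpha> * q) (\<alpha> * p) (- \<beta> * s) (\<beta> * r)) (at v)"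
  unfolding rotated_frame_def
  by (intro has_vector_derivative_vector_4) (auto intro!: derivative_eq_intros)

lemma d_u_rotated_frame:
  assumes "(p has_real_derivative p') (at u)" "(q has_real_derivative q') (at u)"
    "(r has_real_derivative r') (at u)" "(s has_real_derivative s') (at u)"
  shows "d_u (\<lambda>u v. rotated_frame \<alpha> \<beta> v (p u) (q u) (r u) (s u)) u v =
    rotated_frame \<alpha> \<beta> v p' q' r' s'"
  unfolding d_u_def
  by (rule vector_derivative_at, rule vector_derivative_rotated_frame_u) fact+

lemma d_v_rotated_frame:
  "d_v (\<lambda>u v. rotated_frame \<alpha> \<beta> v (p u) (q u) (r u) (s u)) =
    (\<lambda>u v. rotated_frame \<alpha> \<beta> v (- \<alpha> * q u) (\<alpha> * p u) (- \<beta> * s u) (\<beta> * r u))"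
  unfolding d_v_def
  by (intro ext vector_derivative_at vector_derivative_rotated_frame_v)

lemma d_u_cong_open:
  assumes "open J" "u \<in> J" "\<And>t. t \<in> J \<Longrightarrow> y t v = z t v"
  shows "d_u y u v = d_u z u v"
proof -
  have "eventually (\<lambda>t. t \<in> J) (nhds u)"
    using assms by (simp add: eventually_nhds_in_open)
  then have "eventually (\<lambda>t. y t v = z t v) (nhds u)"
    by eventually_elim (rule assms)
  then show ?thesis
    unfolding d_u_def by (intro vector_derivative_cong_eq) auto
qed

section \<open>Curvature of a rotational surface\<close>

text \<open>The Gauss equation for the diagonal metric \<open>E du\<^sup>2 - P dv\<^sup>2\<close>, with both coefficients
  functions of \<open>u\<close>. The products of \<open>z\<^sub>u\<^sub>u\<close>, \<open>z\<^sub>u\<^sub>v\<close> and \<open>z\<^sub>v\<^sub>v\<close> with the tangent frame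
  are constant multiples of \<open>E'\<close> and \<open>P'\<close>, and the terms in \<open>f''\<close> and \<open>g''\<close> that are left combine with
  \<open>\<langle>z\<^sub>u\<^sub>v, z\<^sub>u\<^sub>v\<rangle>\<close> to \<open>P'' / 2\<close>.\<close>

lemma gauss_curvature_rotational:
  fixes E P f g f1 g1 :: "real \<Rightarrow> real"
  assumes E_def: "E = (\<lambda>u. (f1 u)\<^sup>2 - (g1 u)\<^sup>2)"
    and P_def: "P = (\<lambda>u. \<beta>\<^sup>2 * (g u)\<^sup>2 - \<alpha>\<^sup>2 * (f u)\<^sup>2)"
    and "open J" and "u \<in> J"
    and f: "\<And>t. t \<in> J \<Longrightarrow> (f has_real_derivative f1 t) (at t)"
    and g: "\<And>t. t \<in> J \<Longrightarrow> (g has_real_derivative g1 t) (at t)"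
    and f1: "(f1 has_real_derivative f2) (at u)"
    and g1: "(g1 has_real_derivative g2) (at u)"
    and E0: "E u \<noteq> 0" and P0: "P u \<noteq> 0"
    and dE: "(E has_real_derivative E1) (at u)"
    and dP: "\<And>t. t \<in> J \<Longrightarrow> (P has_real_derivative P1 t) (at t)"
    and dP1: "(P1 has_real_derivative P2) (at u)"
  shows "gauss_curvature (rotational_surface \<alpha> \<beta> f g) u v =
    (P u * P1 u * E1 + (P1 u)\<^sup>2 * E u - 2 * P u * P2 * E u) / (4 * (E u)\<^sup>2 * (P u)\<^sup>2)"
proof -
  have E1: "E1 = 2 * (f1 u * f2 - g1 u * g2)"
  proof -
    have "(E has_real_derivative 2 * (f1 u * f2 - g1 u * g2)) (at u)"
      unfolding E_def using f1 g1 by (auto intro!: derivative_eq_intros simp: algebra_simps)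
    then show ?thesis
      using dE DERIV_unique by blast
  qed
  have P1: "P1 t = 2 * (\<beta>\<^sup>2 * (g t * g1 t) - \<alpha>\<^sup>2 * (f t * f1 t))" if "t \<in> J" for t
  proof -
    have "(P has_real_derivative 2 * (\<beta>\<^sup>2 * (g t * g1 t) - \<alpha>\<^sup>2 * (f t * f1 t))) (at t)"
      unfolding P_def using f[OF that] g[OF that]
      by (auto intro!: derivative_eq_intros simp: algebra_simps)
    then show ?thesis
      using dP[OF that] DERIV_unique by blast
  qed
  have P2: "P2 = 2 * (\<beta>\<^sup>2 * (g u * g2 + (g1 u)\<^sup>2) - \<alpha>\<^sup>2 * (f u * f2 + (f1 u)\<^sup>2))"
  proof -
    have "((\<lambda>t. 2 * (\<beta>\<^sup>2 * (g t * g1 t) - \<alpha>\<^sup>2 * (f t * f1 t))) has_real_derivative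
        2 * (\<beta>\<^sup>2 * (g u * g2 + (g1 u)\<^sup>2) - \<alpha>\<^sup>2 * (f u * f2 + (f1 u)\<^sup>2))) (at u)"
      using f[OF \<open>u \<in> J\<close>] g[OF \<open>u \<in> J\<close>] f1 g1
      by (auto intro!: derivative_eq_intros simp: algebra_simps power2_eq_square)
    then have "(P1 has_real_derivative
        2 * (\<beta>\<^sup>2 * (g u * g2 + (g1 u)\<^sup>2) - \<alpha>\<^sup>2 * (f u * f2 + (f1 u)\<^sup>2))) (at u)"
      by (rule has_field_derivative_transform_within_open[OF _ \<open>open J\<close> \<open>u \<in> J\<close>])
        (simp add: P1)
    then show ?thesis
      using dP1 DERIV_unique by blast
  qed
  let ?z = "rotational_surface \<alpha> \<beta> f g"
  have zu: "d_u ?z t v = rotated_frame \<alpha> \<beta> v (f1 t) 0 (g1 t) 0" if "t \<in> J" for t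
    unfolding rotational_surface_frame using f[OF that] g[OF that]
    by (intro d_u_rotated_frame) auto
  have zuu: "d_u (d_u ?z) u v = rotated_frame \<alpha> \<beta> v f2 0 g2 0"
  proof -
    have "d_u (d_u ?z) u v = d_u (\<lambda>u v. rotated_frame \<alpha> \<beta> v (f1 u) 0 (g1 u) 0) u v"
      by (rule d_u_cong_open[OF \<open>open J\<close> \<open>u \<in> J\<close>]) (rule zu)
    also have "\<dots> = rotated_frame \<alpha> \<beta> v f2 0 g2 0"
      using f1 g1 by (intro d_u_rotated_frame) auto
    finally show ?thesis .
  qed
  have zv: "d_v ?z = (\<lambda>u v. rotated_frame \<alpha> \<beta> v 0 (\<alpha> * f u) 0 (\<beta> * g u))"
    unfolding rotational_surface_frame d_v_rotated_frame by simp
  have zuv: "d_u (d_v ?z) u v = rotated_frame \<alpha> \<beta> v 0 (\<alpha> * f1 u) 0 (\<beta> * g1 u)"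
    unfolding zv using f[OF \<open>u \<in> J\<close>] g[OF \<open>u \<in> J\<close>]
    by (intro d_u_rotated_frame) (auto intro!: derivative_eq_intros)
  have zvv: "d_v (d_v ?z) u v = rotated_frame \<alpha> \<beta> v (- \<alpha>\<^sup>2 * f u) 0 (- \<beta>\<^sup>2 * g u) 0"
    unfolding zv d_v_rotated_frame by (simp add: power2_eq_square algebra_simps)
  note frame = zu[OF \<open>u \<in> J\<close>] zuu zuv zvv fun_cong[OF fun_cong[OF zv], of u v]
    neutral_rotated_frame
  have metric_uu: "neutral (d_u ?z u v) (d_u ?z u v) = E u"
    and metric_vv: "neutral (d_v ?z u v) (d_v ?z u v) = - P u"
    and metric_uv: "neutral (d_u ?z u v) (d_v ?z u v) = 0"
    by (simp_all add: frame E_def P_def power2_eq_square algebra_simps)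
  have pairing: "neutral (normal_component (d_u ?z u v) (d_v ?z u v) w)
      (normal_component (d_u ?z u v) (d_v ?z u v) w') =
      neutral w w' - neutral w (d_u ?z u v) * neutral w' (d_u ?z u v) / E u
        + neutral w (d_v ?z u v) * neutral w' (d_v ?z u v) / P u" for w w'
    using neutral_normal_components[of "d_u ?z u v" "d_v ?z u v" w w'] E0 P0
    by (simp add: metric_uu metric_vv metric_uv)
  have "neutral (sigma_uu ?z u v) (sigma_vv ?z u v) =
      \<beta>\<^sup>2 * (g u * g2) - \<alpha>\<^sup>2 * (f u * f2) - (E1 / 2) * (P1 u / 2) / E u"
    unfolding sigma_uu_def sigma_vv_def pairing
    using E0 by (simp add: frame E1 P1[OF \<open>u \<in> J\<close>] field_simps)
  moreover have "neutral (sigma_uv ?z u v) (sigma_uv ?z u v) =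
      \<alpha>\<^sup>2 * (f1 u)\<^sup>2 - \<beta>\<^sup>2 * (g1 u)\<^sup>2 + (P1 u / 2)\<^sup>2 / P u"
    unfolding sigma_uv_def pairing
    using P0 by (simp add: frame P1[OF \<open>u \<in> J\<close>] power2_eq_square field_simps)
  ultimately have "neutral (sigma_uu ?z u v) (sigma_vv ?z u v)
      - neutral (sigma_uv ?z u v) (sigma_uv ?z u v) =
      P2 / 2 - (E1 / 2) * (P1 u / 2) / E u - (P1 u / 2)\<^sup>2 / P u"
    by (simp add: P2 algebra_simps)
  also have "\<dots> = - (P u * P1 u * E1 + (P1 u)\<^sup>2 * E u - 2 * P u * P2 * E u) / (4 * E u * P u)"
    using E0 P0 by (simp add: field_simps power2_eq_square)
  finally have numerator: "neutral (sigma_uu ?z u v) (sigma_vv ?z u v)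
      - neutral (sigma_uv ?z u v) (sigma_uv ?z u v) =
      - (P u * P1 u * E1 + (P1 u)\<^sup>2 * E u - 2 * P u * P2 * E u) / (4 * E u * P u)" .
  show ?thesis
    unfolding gauss_curvature_def metric_uu metric_vv metric_uv numerator using E0 P0
    by (simp add: field_simps power2_eq_square)
qed

section \<open>The flatness equation\<close>

text \<open>The numerator of the curvature is, up to a nonvanishing factor, the derivative of
  \<open>P' / (2 \<surd>P \<surd>E)\<close>, the derivative of \<open>\<surd>P\<close> with respect to arc length. Zero curvature makes
  this quotient a constant \<open>a\<close>. For \<open>a \<noteq> 0\<close>, \<open>\<surd>P / a\<close> has derivative \<open>\<surd>E\<close> and serves as
  the function \<open>s\<close>; for \<open>a = 0\<close>, \<open>P\<close> is constant.\<close>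

lemma curvature_ode_solution:
  fixes E P E1 P1 P2 :: "real \<Rightarrow> real"
  assumes "is_interval J"
    and pos: "\<And>u. u \<in> J \<Longrightarrow> E u > 0" "\<And>u. u \<in> J \<Longrightarrow> P u > 0"
    and dE: "\<And>u. u \<in> J \<Longrightarrow> (E has_real_derivative E1 u) (at u)"
    and dP: "\<And>u. u \<in> J \<Longrightarrow> (P has_real_derivative P1 u) (at u)"
    and dP1: "\<And>u. u \<in> J \<Longrightarrow> (P1 has_real_derivative P2 u) (at u)"
    and ode: "\<And>u. u \<in> J \<Longrightarrow> P u * P1 u * E1 u + (P1 u)\<^sup>2 * E u - 2 * P u * P2 u * E u = 0"
  shows "(\<exists>s a. (\<forall>u\<in>J. (s has_real_derivative sqrt (E u)) (at u)) \<and> a \<noteq> 0 \<and>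
            (\<forall>u\<in>J. P u = a\<^sup>2 * (s u)\<^sup>2)) \<or>
         (\<exists>C>0. \<forall>u\<in>J. P u = C)"
proof -
  define w where "w = (\<lambda>u. P1 u / (2 * sqrt (P u * E u)))"
  have "(w has_real_derivative 0) (at u)" if "u \<in> J" for u
  proof -
    define R where "R = sqrt (P u * E u)"
    have R: "R > 0" "R\<^sup>2 = P u * E u"
      using pos[OF that] by (simp_all add: R_def)
    have dQ: "((\<lambda>t. sqrt (P t * E t)) has_real_derivative
        (P1 u * E u + P u * E1 u) / (2 * R)) (at u)"
    proof -
      have "P u * E u > 0"
        using pos[OF that] by simp
      from DERIV_chain2[OF DERIV_real_sqrt[OF this] DERIV_mult[OF dP[OF that] dE[OF that]]]
      show ?thesis
        unfolding R_def[symmetric] by (rule DERIV_cong) (use R(1) in \<open>simp add: field_simps\<close>)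
    qed
    have "(w has_real_derivative (P2 u * (2 * R)
        - P1 u * (2 * ((P1 u * E u + P u * E1 u) / (2 * R)))) / ((2 * R) * (2 * R))) (at u)"
      using DERIV_divide[OF dP1[OF that] DERIV_cmult[OF dQ, of 2]] pos[OF that]
      unfolding w_def R_def by simp
    moreover have "P2 u * (2 * R) - P1 u * (2 * ((P1 u * E u + P u * E1 u) / (2 * R))) =
        (2 * P2 u * R\<^sup>2 - P1 u * (P1 u * E u + P u * E1 u)) / R"
      using R(1) by (simp add: field_simps power2_eq_square)
    moreover have "2 * P2 u * R\<^sup>2 - P1 u * (P1 u * E u + P u * E1 u) = 0"
      using ode[OF that] unfolding R(2) by (simp add: algebra_simps power2_eq_square)
    ultimately show ?thesis
      by simp
  qed
  then obtain a where a: "\<And>u. u \<in> J \<Longrightarrow> w u = a"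
    using has_field_derivative_zero_constant[of J w] \<open>is_interval J\<close> is_interval_convex_1[of J]
    by (blast intro: has_field_derivative_at_within)
  have P1: "P1 u = a * (2 * sqrt (P u) * sqrt (E u))" if "u \<in> J" for u
    using a[OF that] pos[OF that] by (simp add: w_def real_sqrt_mult field_simps)
  show ?thesis
  proof (cases "a = 0")
    case True
    then have "(P has_real_derivative 0) (at u within J)" if "u \<in> J" for u
      using dP[OF that] P1[OF that] by (auto intro: has_field_derivative_at_within)
    then obtain C where C: "\<And>u. u \<in> J \<Longrightarrow> P u = C"
      using has_field_derivative_zero_constant[of J P] \<open>is_interval J\<close> is_interval_convex_1[of J]
      by blast
    \<comment> \<open>On the empty interval \<open>C\<close> need not be positive, and any positive number will do.\<close>
    show ?thesis
    proof (cases "J = {}")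
      case True
      then show ?thesis by (auto intro: exI[of _ 1])
    next
      case False
      then have "C > 0" using C pos(2) by fastforce
      then show ?thesis using C by blast
    qed
  next
    case False
    define s where "s = (\<lambda>u. sqrt (P u) / a)"
    have "(s has_real_derivative sqrt (E u)) (at u)" if "u \<in> J" for u
      unfolding s_def using dP[OF that] pos[OF that] P1[OF that] False
      by (auto intro!: derivative_eq_intros simp: field_simps)
    moreover have "P u = a\<^sup>2 * (s u)\<^sup>2" if "u \<in> J" for u
      using pos[OF that] False by (simp add: s_def power_divide)
    ultimately show ?thesis
      using False by blast
  qed
qed

text \<open>Differentiating \<open>a\<^sup>2 (s + c)\<^sup>2\<close> rather than its square root makes the sign of \<open>s + c\<close>
  irrelevant.\<close>

lemma curvature_ode_affine:
  fixes E P P1 s :: "real \<Rightarrow> real" and E1 P2 a c :: real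
  assumes "open J" and "u \<in> J"
    and pos: "\<And>t. t \<in> J \<Longrightarrow> E t > 0"
    and dE: "(E has_real_derivative E1) (at u)"
    and dP: "\<And>t. t \<in> J \<Longrightarrow> (P has_real_derivative P1 t) (at t)"
    and dP1: "(P1 has_real_derivative P2) (at u)"
    and ds: "\<And>t. t \<in> J \<Longrightarrow> (s has_real_derivative sqrt (E t)) (at t)"
    and P: "\<And>t. t \<in> J \<Longrightarrow> P t = a\<^sup>2 * (s t + c)\<^sup>2"
  shows "P u * P1 u * E1 + (P1 u)\<^sup>2 * E u - 2 * P u * P2 * E u = 0"
proof -
  have P1: "P1 t = 2 * a\<^sup>2 * (s t + c) * sqrt (E t)" if "t \<in> J" for t
  proof -
    have "((\<lambda>t. a\<^sup>2 * (s t + c)\<^sup>2) has_real_derivative 2 * a\<^sup>2 * (s t + c) * sqrt (E t)) (at t)"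
      using ds[OF that] by (auto intro!: derivative_eq_intros)
    then have "(P has_real_derivative 2 * a\<^sup>2 * (s t + c) * sqrt (E t)) (at t)"
      by (rule has_field_derivative_transform_within_open[OF _ \<open>open J\<close> that]) (simp add: P)
    then show ?thesis
      using dP[OF that] DERIV_unique by blast
  qed
  define r where "r = sqrt (E u)"
  have r: "r > 0" "E u = r\<^sup>2"
    using pos[OF \<open>u \<in> J\<close>] by (simp_all add: r_def)
  have "((\<lambda>t. 2 * a\<^sup>2 * (s t + c) * sqrt (E t)) has_real_derivative
      2 * a\<^sup>2 * (r\<^sup>2 + (s u + c) * (E1 / (2 * r)))) (at u)"
    using ds[OF \<open>u \<in> J\<close>] dE pos[OF \<open>u \<in> J\<close>]
    by (auto intro!: derivative_eq_intros simp: r_def field_simps)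
  then have "(P1 has_real_derivative 2 * a\<^sup>2 * (r\<^sup>2 + (s u + c) * (E1 / (2 * r)))) (at u)"
    by (rule has_field_derivative_transform_within_open[OF _ \<open>open J\<close> \<open>u \<in> J\<close>]) (simp add: P1)
  then have "P2 = 2 * a\<^sup>2 * (r\<^sup>2 + (s u + c) * (E1 / (2 * r)))"
    using dP1 DERIV_unique by blast
  then have P2: "P2 * r = a\<^sup>2 * (2 * r ^ 3 + (s u + c) * E1)"
    using r(1) by (simp add: field_simps power2_eq_square power3_eq_cube)
  have "P1 u = 2 * a\<^sup>2 * (s u + c) * r"
    using P1[OF \<open>u \<in> J\<close>] by (simp add: r_def)
  then show ?thesis
    using P2 unfolding r(2) P[OF \<open>u \<in> J\<close>] by algebra
qed

lemma curvature_ode_constant: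
  fixes P P1 :: "real \<Rightarrow> real"
  assumes "open J" and "u \<in> J"
    and dP: "\<And>t. t \<in> J \<Longrightarrow> (P has_real_derivative P1 t) (at t)"
    and dP1: "(P1 has_real_derivative P2) (at u)"
    and P: "\<And>t. t \<in> J \<Longrightarrow> P t = C"
  shows "P1 u = 0" "P2 = 0"
proof -
  have P1: "P1 t = 0" if "t \<in> J" for t
  proof -
    have "(P has_real_derivative 0) (at t)"
      by (rule has_field_derivative_transform_within_open[OF DERIV_const \<open>open J\<close> that, of C])
        (simp add: P)
    then show ?thesis
      using dP[OF that] DERIV_unique by blast
  qed
  then show "P1 u = 0"
    using \<open>u \<in> J\<close> .
  have "(P1 has_real_derivative 0) (at u)"
    by (rule has_field_derivative_transform_within_open[OF DERIV_const \<open>open J\<close> \<open>u \<in> J\<close>, of 0])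
      (simp add: P1)
  then show "P2 = 0"
    using dP1 DERIV_unique by blast
qed

section \<open>Flat rotational surfaces\<close>

lemma smooth_on_DERIV:
  assumes "smooth_on J f" "u \<in> J"
  shows "(f has_real_derivative deriv f u) (at u)"
    and "(deriv f has_real_derivative deriv (deriv f) u) (at u)"
proof -
  have "(deriv ^^ n) f differentiable (at u)" for n
    using assms by (simp add: smooth_on_def)
  from this[of 0] this[of 1] show "(f has_real_derivative deriv f u) (at u)"
    and "(deriv f has_real_derivative deriv (deriv f) u) (at u)"
    by (simp_all add: DERIV_deriv_iff_real_differentiable)
qed

lemma arc_length_parameter_meridian_iff:
  assumes "smooth_on J f" "smooth_on J g"
  shows "arc_length_parameter J (meridian_curve f g) s \<longleftrightarrow>
    (\<forall>u\<in>J. (s has_real_derivative sqrt ((deriv f u)\<^sup>2 - (deriv g u)\<^sup>2)) (at u))"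
proof -
  have "vector_derivative (meridian_curve f g) (at u) = vector [deriv f u, 0, deriv g u, 0]"
    if "u \<in> J" for u
    unfolding meridian_curve_def
    using smooth_on_DERIV(1)[OF assms(1) that] smooth_on_DERIV(1)[OF assms(2) that]
    by (intro vector_derivative_at has_vector_derivative_vector_4) auto
  then show ?thesis
    by (simp add: arc_length_parameter_def neutral_def power2_eq_square)
qed

theorem theorem6p1:
  fixes \<alpha> \<beta> :: real and f g :: "real \<Rightarrow> real" and J :: "real set"
  assumes "\<alpha> > 0" and "\<beta> > 0"
    and "open J" and "is_interval J"
    and "smooth_on J f" and "smooth_on J g"
    and "\<And>u. u \<in> J \<Longrightarrow> \<alpha>\<^sup>2 * (f u)\<^sup>2 - \<beta>\<^sup>2 * (g u)\<^sup>2 < 0"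
    and "\<And>u. u \<in> J \<Longrightarrow> (deriv f u)\<^sup>2 - (deriv g u)\<^sup>2 > 0"
  shows "(flat_surface J {0..<2 * pi} (rotational_surface \<alpha> \<beta> f g) \<longleftrightarrow>
            (\<exists>s a c. arc_length_parameter J (meridian_curve f g) s \<and> a \<noteq> 0 \<and>
               (\<forall>u\<in>J. \<beta>\<^sup>2 * (g u)\<^sup>2 - \<alpha>\<^sup>2 * (f u)\<^sup>2 = a\<^sup>2 * (s u + c)\<^sup>2)) \<or>
            (\<exists>C. C < 0 \<and> (\<forall>u\<in>J. \<alpha>\<^sup>2 * (f u)\<^sup>2 - \<beta>\<^sup>2 * (g u)\<^sup>2 = C)))
       \<and> ((\<forall>u\<in>J. (deriv f u)\<^sup>2 - (deriv g u)\<^sup>2 = 1) \<longrightarrow>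
            (flat_surface J {0..<2 * pi} (rotational_surface \<alpha> \<beta> f g) \<longleftrightarrow>
               (\<exists>a c. a \<noteq> 0 \<and>
                  (\<forall>u\<in>J. \<beta>\<^sup>2 * (g u)\<^sup>2 - \<alpha>\<^sup>2 * (f u)\<^sup>2 = a\<^sup>2 * (u + c)\<^sup>2)) \<or>
               (\<exists>C. C < 0 \<and> (\<forall>u\<in>J. \<alpha>\<^sup>2 * (f u)\<^sup>2 - \<beta>\<^sup>2 * (g u)\<^sup>2 = C))))"
    (is "(?flat \<longleftrightarrow> ?affine \<or> ?const) \<and> (?unit \<longrightarrow> (?flat \<longleftrightarrow> ?affine1 \<or> ?const))")
proof -
  define E where "E = (\<lambda>u. (deriv f u)\<^sup>2 - (deriv g u)\<^sup>2)"
  define P where "P = (\<lambda>u. \<beta>\<^sup>2 * (g u)\<^sup>2 - \<alpha>\<^sup>2 * (f u)\<^sup>2)"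
  define f2 where "f2 = deriv (deriv f)"
  define g2 where "g2 = deriv (deriv g)"
  define E1 where "E1 = (\<lambda>u. 2 * (deriv f u * f2 u - deriv g u * g2 u))"
  define P1 where "P1 = (\<lambda>u. 2 * (\<beta>\<^sup>2 * (g u * deriv g u) - \<alpha>\<^sup>2 * (f u * deriv f u)))"
  define P2 where "P2 = (\<lambda>u. 2 * (\<beta>\<^sup>2 * (g u * g2 u + (deriv g u)\<^sup>2)
    - \<alpha>\<^sup>2 * (f u * f2 u + (deriv f u)\<^sup>2)))"
  note df = smooth_on_DERIV[OF \<open>smooth_on J f\<close>, folded f2_def]
  note dg = smooth_on_DERIV[OF \<open>smooth_on J g\<close>, folded g2_def]
  have E: "E u > 0" and P: "P u > 0" if "u \<in> J" for u
    using assms(7,8)[OF that] by (simp_all add: E_def P_def)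
  have dE: "(E has_real_derivative E1 u) (at u)" if "u \<in> J" for u
    unfolding E_def E1_def using df[OF that] dg[OF that]
    by (auto intro!: derivative_eq_intros simp: algebra_simps)
  have dP: "(P has_real_derivative P1 u) (at u)" if "u \<in> J" for u
    unfolding P_def P1_def using df[OF that] dg[OF that]
    by (auto intro!: derivative_eq_intros simp: algebra_simps)
  have dP1: "(P1 has_real_derivative P2 u) (at u)" if "u \<in> J" for u
    unfolding P1_def P2_def using df[OF that] dg[OF that]
    by (auto intro!: derivative_eq_intros simp: algebra_simps power2_eq_square)
  let ?ode = "\<lambda>u. P u * P1 u * E1 u + (P1 u)\<^sup>2 * E u - 2 * P u * P2 u * E u = 0"
  have curvature: "gauss_curvature (rotational_surface \<alpha> \<beta> f g) u v =
      (P u * P1 u * E1 u + (P1 u)\<^sup>2 * E u - 2 * P u * P2 u * E u) / (4 * (E u)\<^sup>2 * (P u)\<^sup>2)"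
    if "u \<in> J" for u v
    using gauss_curvature_rotational[OF E_def P_def \<open>open J\<close> that df(1) dg(1) df(2)[OF that]
        dg(2)[OF that] _ _ dE[OF that] dP dP1[OF that]] E[OF that] P[OF that]
    by simp
  have "gauss_curvature (rotational_surface \<alpha> \<beta> f g) u v = 0 \<longleftrightarrow> ?ode u"
    if "u \<in> J" for u v
    using E[OF that] P[OF that] by (simp add: curvature[OF that])
  moreover have "(0::real) \<in> {0..<2 * pi}"
    by simp
  ultimately have flat: "?flat \<longleftrightarrow> (\<forall>u\<in>J. ?ode u)"
    unfolding flat_surface_def by blast
  note arc = arc_length_parameter_meridian_iff[OF \<open>smooth_on J f\<close> \<open>smooth_on J g\<close>]
  have affine: "?affine \<longleftrightarrow> (\<exists>s a c. (\<forall>u\<in>J. (s has_real_derivative sqrt (E u)) (at u)) \<and>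
      a \<noteq> 0 \<and> (\<forall>u\<in>J. P u = a\<^sup>2 * (s u + c)\<^sup>2))"
    by (simp add: arc E_def P_def)
  have neg: "\<alpha>\<^sup>2 * (f u)\<^sup>2 - \<beta>\<^sup>2 * (g u)\<^sup>2 = - P u" for u
    by (simp add: P_def)
  have const: "?const \<longleftrightarrow> (\<exists>C>0. \<forall>u\<in>J. P u = C)"
    unfolding neg by (metis neg_0_less_iff_less neg_less_0_iff_less minus_minus)
  have main: "?flat \<longleftrightarrow> ?affine \<or> ?const"
  proof
    assume ?flat
    then have ode: "?ode u" if "u \<in> J" for u
      using flat that by blast
    from curvature_ode_solution[OF \<open>is_interval J\<close> E P dE dP dP1 ode] show "?affine \<or> ?const"
    proof
      assume "\<exists>s a. (\<forall>u\<in>J. (s has_real_derivative sqrt (E u)) (at u)) \<and> a \<noteq> 0 \<and>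
        (\<forall>u\<in>J. P u = a\<^sup>2 * (s u)\<^sup>2)"
      then have ?affine
        unfolding affine by (metis add_0_right)
      then show ?thesis ..
    next
      assume "\<exists>C>0. \<forall>u\<in>J. P u = C"
      then show ?thesis
        using const by blast
    qed
  next
    assume "?affine \<or> ?const"
    then show ?flat
    proof
      assume ?affine
      then obtain s a c where s: "\<And>u. u \<in> J \<Longrightarrow> (s has_real_derivative sqrt (E u)) (at u)"
        and Ps: "\<And>u. u \<in> J \<Longrightarrow> P u = a\<^sup>2 * (s u + c)\<^sup>2"
        unfolding affine by blast
      show ?flat
        unfolding flat
      proof
        fix u assume "u \<in> J"
        show "?ode u"
          using curvature_ode_affine[OF \<open>open J\<close> \<open>u \<in> J\<close> E dE[OF \<open>u \<in> J\<close>] dP dP1[OF \<open>u \<in> J\<close>] s Ps] .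
      qed
    next
      assume ?const
      then obtain C where C: "\<And>u. u \<in> J \<Longrightarrow> P u = C"
        unfolding const by blast
      show ?flat
        unfolding flat
      proof
        fix u assume "u \<in> J"
        show "?ode u"
          using curvature_ode_constant[OF \<open>open J\<close> \<open>u \<in> J\<close> dP dP1[OF \<open>u \<in> J\<close>] C] by simp
      qed
    qed
  qed
  \<comment> \<open>For a unit-speed meridian the arc-length parameters are the translates of \<open>u\<close>.\<close>
  have "?affine \<longleftrightarrow> ?affine1" if unit: ?unit
  proof
    assume ?affine
    then obtain s a c where s: "\<And>u. u \<in> J \<Longrightarrow> (s has_real_derivative sqrt (E u)) (at u)"
      and "a \<noteq> 0" and Ps: "\<And>u. u \<in> J \<Longrightarrow> P u = a\<^sup>2 * (s u + c)\<^sup>2"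
      unfolding affine by blast
    have "((\<lambda>u. s u - u) has_real_derivative 0) (at u within J)" if "u \<in> J" for u
    proof -
      have "E u = 1"
        using unit that by (simp add: E_def)
      then show ?thesis
        using DERIV_diff[OF s[OF that] DERIV_ident] by (simp add: has_field_derivative_at_within)
    qed
    then obtain k where "\<And>u. u \<in> J \<Longrightarrow> s u - u = k"
      using has_field_derivative_zero_constant[of J "\<lambda>u. s u - u"] \<open>is_interval J\<close>
        is_interval_convex_1[of J] by blast
    then have "s u + c = u + (k + c)" if "u \<in> J" for u
      using that by (simp add: algebra_simps)
    then have "\<forall>u\<in>J. \<beta>\<^sup>2 * (g u)\<^sup>2 - \<alpha>\<^sup>2 * (f u)\<^sup>2 = a\<^sup>2 * (u + (k + c))\<^sup>2"
      using Ps by (metis P_def)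
    then show ?affine1
      using \<open>a \<noteq> 0\<close> by blast
  next
    assume ?affine1
    moreover have "arc_length_parameter J (meridian_curve f g) (\<lambda>u. u)"
      using unit by (simp add: arc)
    ultimately show ?affine
      by blast
  qed
  then show ?thesis
    using main by blast
qed

end
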